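(* Let $B$ be a unital $C^*$-algebra and let $M\subset B$ be a unital subspace. Let $\omega$ be a state on $B$. Consider the following statements. (i) $\omega$ is a $\mathcal{Q}(M)$-peak state. (ii) There is a non-empty $\mathcal{Q}(M)$-peak set contained in $E_\omega$. (iii) There is $x\in M\cap\Sigma^{\mathcal{Q}}_\omega$ such that $\{\omega|_M\}=R^{\mathcal{Q}}_x$. (iv) $\omega$ is an $M$-peak state. (v) There is a non-empty $M$-peak set contained in $E_\omega$. (vi) There is $x\in M\cap\Sigma^{\operatorname{nr}}_\omega$ such that $\{\omega|_M\}=R^{\operatorname{nr}}_x$. Then (i) $\Rightarrow$ (ii) $\Leftrightarrow$ (iii) and (iv) $\Rightarrow$ (v) $\Leftrightarrow$ (vi). When $\omega|_M$ admits a unique extension to a state on $B$, then (i) $\Leftrightarrow$ (ii) $\Leftrightarrow$ (iii) and (iv) $\Leftrightarrow$ (v) $\Leftrightarrow$ (vi).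
   Context: A unital subspace is a complex linear subspace containing the unit. $\mathcal{S}(B)$ is the state space of $B$ (unital contractive linear functionals). $E_\omega=\{\psi\in\mathcal{S}(B):\psi|_M=\omega|_M\}$ and $\mathcal{Q}(M)=\{a^*a:a\in M\}$. For a subset $X\subset B$, a subset $E\subset\mathcal{S}(B)$ is an $X$-peak set if there is $x\in X$ such that $\phi(x)=1$ for every $\phi\in E$, while $|\psi(x)|<1$ for every $\psi\in\mathcal{S}(B)\setminus E$. A state $\omega$ is an $X$-peak state if $\{\omega\}$ is an $X$-peak set. The numerical radius of $b\in B$ is $\operatorname{nr}(b)=\sup_{\phi\in\mathcal{S}(B)}|\phi(b)|$. For $b\in B$ define $$N^{\mathcal{Q}}_b=\{\phi\in\mathcal{S}(B):\phi(b^*b)=\|b\|^2\},\quad R^{\mathcal{Q}}_b=\{\phi|_M:\phi\in N^{\mathcal{Q}}_b\},$$ $$N^{\operatorname{nr}}_b=\{\phi\in\mathcal{S}(B):|\phi(b)|=\operatorname{nr}(b)\},\quad R^{\operatorname{nr}}_b=\{\phi|_M:\phi\in N^{\operatorname{nr}}_b\}.$$ For a state $\omega$ on $B$, $\Sigma^{\mathcal{Q}}_\omega$ is the set of $b\in B$ with $\|b\|=1$ and $R^{\mathcal{Q}}_b=\{\omega|_M\}$, and $\Sigma^{\operatorname{nr}}_\omega$ is the set of $b\in B$ with $\operatorname{nr}(b)=1$ and $R^{\operatorname{nr}}_b=\{\omega|_M\}$. *)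

theory Defs
  imports "HOL-Analysis.Analysis"
begin

text \<open>Unital \<open>C\<^sup>*\<close>-algebras as a type class.  The superclass \<open>real_normed_algebra_1\<close> contains
  \<open>0 \<noteq> 1\<close> and \<open>norm 1 = 1\<close>; the zero algebra, which is thereby excluded, has no states, and
  \<open>norm 1 = 1\<close> holds in every other unital \<open>C\<^sup>*\<close>-algebra.\<close>

class unital_cstar_algebra = real_normed_algebra_1 + banach +
  fixes scaleC :: "complex \<Rightarrow> 'a \<Rightarrow> 'a"  (infixr \<open>*\<^sub>C\<close> 75)
    and adj :: "'a \<Rightarrow> 'a"
  assumes scaleC_add_right: "c *\<^sub>C (x + y) = c *\<^sub>C x + c *\<^sub>C y"
    and scaleC_add_left: "(c + d) *\<^sub>C x = c *\<^sub>C x + d *\<^sub>C x"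
    and scaleC_scaleC: "c *\<^sub>C d *\<^sub>C x = (c * d) *\<^sub>C x"
    and scaleC_one: "1 *\<^sub>C x = x"
    and scaleC_of_real: "of_real r *\<^sub>C x = r *\<^sub>R x"
    and mult_scaleC_left: "(c *\<^sub>C x) * y = c *\<^sub>C (x * y)"
    and mult_scaleC_right: "x * (c *\<^sub>C y) = c *\<^sub>C (x * y)"
    and norm_scaleC: "norm (c *\<^sub>C x) = cmod c * norm x"
    and adj_adj: "adj (adj x) = x"
    and adj_add: "adj (x + y) = adj x + adj y"
    and adj_scaleC: "adj (c *\<^sub>C x) = cnj c *\<^sub>C adj x"
    and adj_mult: "adj (x * y) = adj y * adj x"
    and cstar_identity: "norm (adj x * x) = (norm x)\<^sup>2"

global_interpretation complex_vector: vector_space "scaleC :: complex \<Rightarrow> 'a \<Rightarrow> 'a::unital_cstar_algebra"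
  by unfold_locales
    (simp_all only: scaleC_add_right scaleC_add_left scaleC_scaleC scaleC_one)

instantiation complex :: unital_cstar_algebra
begin

definition scaleC_complex :: "complex \<Rightarrow> complex \<Rightarrow> complex" where "scaleC_complex = (*)"

definition adj_complex :: "complex \<Rightarrow> complex" where "adj_complex = cnj"

instance
  by standard
    (simp_all add: scaleC_complex_def adj_complex_def algebra_simps norm_mult scaleR_conv_of_real
      power2_eq_square)

end

definition unital_subspace :: "'a::unital_cstar_algebra set \<Rightarrow> bool" where
  "unital_subspace M \<longleftrightarrow> complex_vector.subspace M \<and> 1 \<in> M"

definition state_space :: "('a::unital_cstar_algebra \<Rightarrow> complex) set" where
  "state_space = {\<phi>. Vector_Spaces.linear scaleC (*) \<phi> \<and> (\<forall>b. cmod (\<phi> b) \<le> norm b) \<and> \<phi> 1 = 1}"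

text \<open>The restriction of a functional \<open>\<phi>\<close> to \<open>M\<close> is rendered as \<open>restrict \<phi> M\<close>, the function
  that agrees with \<open>\<phi>\<close> on \<open>M\<close> and is \<open>undefined\<close> elsewhere.\<close>

definition E_set ::
  "'a::unital_cstar_algebra set \<Rightarrow> ('a \<Rightarrow> complex) \<Rightarrow> ('a \<Rightarrow> complex) set" where
  "E_set M \<omega> = {\<psi> \<in> state_space. restrict \<psi> M = restrict \<omega> M}"

definition Q_set :: "'a::unital_cstar_algebra set \<Rightarrow> 'a set" where
  "Q_set M = {adj a * a | a. a \<in> M}"

definition peak_set :: "'a::unital_cstar_algebra set \<Rightarrow> ('a \<Rightarrow> complex) set \<Rightarrow> bool" where
  "peak_set X E \<longleftrightarrow> E \<subseteq> state_space \<and>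
    (\<exists>x\<in>X. (\<forall>\<phi>\<in>E. \<phi> x = 1) \<and> (\<forall>\<psi>\<in>state_space - E. cmod (\<psi> x) < 1))"

definition peak_state :: "'a::unital_cstar_algebra set \<Rightarrow> ('a \<Rightarrow> complex) \<Rightarrow> bool" where
  "peak_state X \<omega> \<longleftrightarrow> peak_set X {\<omega>}"

definition nr :: "'a::unital_cstar_algebra \<Rightarrow> real" where
  "nr b = (SUP \<phi>\<in>state_space. cmod (\<phi> b))"

definition N_Q :: "'a::unital_cstar_algebra \<Rightarrow> ('a \<Rightarrow> complex) set" where
  "N_Q b = {\<phi> \<in> state_space. \<phi> (adj b * b) = of_real ((norm b)\<^sup>2)}"

definition R_Q :: "'a::unital_cstar_algebra set \<Rightarrow> 'a \<Rightarrow> ('a \<Rightarrow> complex) set" where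
  "R_Q M b = {restrict \<phi> M | \<phi>. \<phi> \<in> N_Q b}"

definition N_nr :: "'a::unital_cstar_algebra \<Rightarrow> ('a \<Rightarrow> complex) set" where
  "N_nr b = {\<phi> \<in> state_space. cmod (\<phi> b) = nr b}"

definition R_nr :: "'a::unital_cstar_algebra set \<Rightarrow> 'a \<Rightarrow> ('a \<Rightarrow> complex) set" where
  "R_nr M b = {restrict \<phi> M | \<phi>. \<phi> \<in> N_nr b}"

definition Sigma_Q :: "'a::unital_cstar_algebra set \<Rightarrow> ('a \<Rightarrow> complex) \<Rightarrow> 'a set" where
  "Sigma_Q M \<omega> = {b. norm b = 1 \<and> R_Q M b = {restrict \<omega> M}}"

definition Sigma_nr :: "'a::unital_cstar_algebra set \<Rightarrow> ('a \<Rightarrow> complex) \<Rightarrow> 'a set" where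
  "Sigma_nr M \<omega> = {b. nr b = 1 \<and> R_nr M b = {restrict \<omega> M}}"

end

theory Submission
  imports Defs
begin

text \<open>
  A nonempty peak set inside \<open>E_set M \<omega>\<close> and a norming set with restriction \<open>\<omega>\<close> are the same set of
  states seen twice: if \<open>E\<close> is the peak set of \<open>x\<close>, respectively of \<open>x\<^sup>* x\<close>, then \<open>E = N_nr x\<close>,
  respectively \<open>E = N_Q x\<close>, and \<open>E \<subseteq> E_set M \<omega>\<close> says that all members of \<open>E\<close> restrict to
  \<open>\<omega>\<close> on \<open>M\<close>. When \<open>\<omega>\<close> is the only state with its restriction, \<open>E_set M \<omega> = {\<omega>}\<close>, and such an \<open>E\<close> is \<open>{\<omega>}\<close>.

  For the numerical radius this is bookkeeping, up to a rotation of \<open>x\<close>. For \<open>Q_set M\<close>, two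
  facts about \<open>C\<^sup>*\<close>-algebras enter: the norm of a self-adjoint element is bounded by the values of
  states on it (\<open>norm_self_adjoint_le\<close>), which gives \<open>norm x = 1\<close> for a peak set of \<open>x\<^sup>* x\<close>; and
  a state is real at \<open>x\<^sup>* x\<close> and does not take the value \<open>-1\<close> there when \<open>norm x = 1\<close>
  (\<open>state_ne_minus_one\<close>), so that a value of modulus 1 is the value 1.

  Both facts are derived from norm inequalities, without spectral theory. A self-adjoint \<open>h\<close>
  with \<open>norm h < 1\<close> has a self-adjoint root of \<open>1 - h\<close> (\<open>self_adjoint_sqrt\<close>). This makes
  \<open>s + \<i> k\<close>, with \<open>s\<^sup>2 + k\<^sup>2 = 1\<close>, unitary, and turns the bounds \<open>0 \<le> s\<^sup>2 \<le> \<rho>\<close> into a norm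
  estimate (\<open>norm_square_minus_half\<close>). From it follow the additivity
  \<open>norm (s\<^sup>2 + \<tau>) = norm (s\<^sup>2) + \<tau>\<close> (\<open>norm_square_plus\<close>) and, by a Hahn-Banach argument, states
  that attain the norm of \<open>s\<^sup>2\<close>.
\<close>

section \<open>The involution\<close>

lemma adj_zero [simp]: "adj (0::'a::unital_cstar_algebra) = 0"
  using adj_add[of 0 "0::'a"] by simp

lemma adj_minus [simp]: "adj (- x) = - adj (x::'a::unital_cstar_algebra)"
  using adj_add[of x "-x"] by (simp add: eq_neg_iff_add_eq_0 add.commute)

lemma adj_diff: "adj (x - y) = adj x - adj (y::'a::unital_cstar_algebra)"
  using adj_add[of x "-y"] by simp

lemma adj_one [simp]: "adj (1::'a::unital_cstar_algebra) = 1"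
  using adj_mult[of "adj 1" "1::'a"] by (simp add: adj_adj)

lemma adj_scaleR [simp]: "adj (r *\<^sub>R x) = r *\<^sub>R adj (x::'a::unital_cstar_algebra)"
  using adj_scaleC[of "of_real r" x] by (simp add: scaleC_of_real)

lemma norm_adj [simp]: "norm (adj x) = norm (x::'a::unital_cstar_algebra)"
proof -
  have le: "norm x \<le> norm (adj x)" for x :: 'a
  proof (cases "x = 0")
    case False
    have "norm x * norm x \<le> norm (adj x) * norm x"
      using cstar_identity[of x] norm_mult_ineq[of "adj x" x] by (simp add: power2_eq_square)
    then show ?thesis using False by simp
  qed simp
  show ?thesis using le[of x] le[of "adj x"] by (simp add: adj_adj)
qed

lemma cstar_identity': "norm (x * adj x) = (norm (x::'a::unital_cstar_algebra))\<^sup>2"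
  using cstar_identity[of "adj x"] by (simp add: adj_adj)

lemma norm_square_self_adjoint:
  "adj s = s \<Longrightarrow> norm (s * s) = (norm (s::'a::unital_cstar_algebra))\<^sup>2"
  using cstar_identity[of s] by simp

lemma bounded_linear_adj: "bounded_linear (adj :: 'a::unital_cstar_algebra \<Rightarrow> 'a)"
  by (rule bounded_linear_intro[where K=1]) (simp_all add: adj_add)

section \<open>Squares of self-adjoint elements\<close>

text \<open>
  Writing \<open>k = 1 - y\<close>, the equation \<open>k * k = 1 - h\<close> becomes the fixed-point equation
  \<open>y = (h + y * y) / 2\<close>, whose right-hand side contracts the ball of radius \<open>norm h < 1\<close>.
  It also preserves the closed set of self-adjoint elements commuting with a given \<open>z\<close>, so the
  root inherits both properties.
\<close>

lemma self_adjoint_sqrt: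
  fixes h :: "'a::unital_cstar_algebra"
  assumes h: "adj h = h" "norm h < 1" and z: "z * h = h * z"
  obtains k where "adj k = k" "k * k = 1 - h" "z * k = k * z"
proof -
  define F where "F y = (1/2) *\<^sub>R (h + y * y)" for y
  define S where "S = cball 0 (norm h) \<inter> {y. adj y = y} \<inter> {y. z * y = y * z}"
  have "closed S" unfolding S_def
    by (intro closed_Int closed_cball closed_Collect_eq continuous_intros
        linear_continuous_on[OF bounded_linear_adj])
  then have "complete S" by (simp add: complete_eq_closed)
  moreover have "S \<noteq> {}" proof -
    have "0 \<in> S" by (simp add: S_def)
    then show ?thesis by blast
  qed
  moreover have "F ` S \<subseteq> S"
  proof (rule image_subsetI)
    fix y assume y: "y \<in> S"
    have "norm (y * y) \<le> norm h * norm h"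
      using y norm_mult_ineq[of y y] mult_mono[of "norm y" "norm h" "norm y" "norm h"]
      by (auto simp: S_def)
    also have "\<dots> \<le> norm h" using h(2) mult_left_le[of "norm h" "norm h"] by simp
    finally have "norm (F y) \<le> norm h"
      using norm_triangle_ineq[of h "y * y"] by (simp add: F_def)
    moreover have "z * (y * y) = y * y * z"
      using y unfolding S_def by (metis (mono_tags, lifting) IntE mem_Collect_eq mult.assoc)
    ultimately show "F y \<in> S"
      using y h(1) z by (auto simp: S_def F_def adj_add adj_mult algebra_simps)
  qed
  moreover have "dist (F x) (F y) \<le> norm h * dist x y" if "x \<in> S" "y \<in> S" for x y
  proof -
    have "x * x - y * y = x * (x - y) + (x - y) * y" by (simp add: algebra_simps)
    then have "norm (x * x - y * y) \<le> norm x * norm (x - y) + norm (x - y) * norm y"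
      by (metis add_mono norm_mult_ineq norm_triangle_mono)
    also have "\<dots> \<le> norm h * norm (x - y) + norm (x - y) * norm h"
      using that by (intro add_mono mult_mono) (auto simp: S_def)
    finally have "norm (x * x - y * y) \<le> 2 * (norm h * norm (x - y))" by simp
    moreover have "F x - F y = (1/2) *\<^sub>R (x * x - y * y)"
      by (simp add: F_def algebra_simps)
    ultimately show ?thesis by (simp add: dist_norm)
  qed
  ultimately obtain y where y: "y \<in> S" "F y = y"
    using Banach_fix[of S "norm h" F] h(2) by auto
  have "2 *\<^sub>R y = 2 *\<^sub>R F y" using y(2) by simp
  then have "h + y * y = 2 *\<^sub>R y" by (simp add: F_def)
  then have "(1 - y) * (1 - y) = 1 - h"
    by (simp add: algebra_simps scaleR_2)
  then show thesis
    using y(1) by (intro that[of "1 - y"]) (auto simp: S_def adj_diff algebra_simps)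
qed

text \<open>
  The norm form of \<open>0 \<le> s\<^sup>2 \<le> \<rho>\<close>. After scaling to \<open>\<rho> = 1\<close>, take \<open>k\<close> with \<open>t\<^sup>2 + k\<^sup>2 = 1\<close>
  commuting with \<open>t\<close>; then \<open>u = t + \<i> k\<close> is unitary and \<open>2 t\<^sup>2 - 1\<close> is the average of
  \<open>u\<^sup>2\<close> and \<open>(u\<^sup>*)\<^sup>2\<close>, hence a contraction. Positivity of states on squares rests on this
  inequality, which bounds the distance of \<open>\<phi> (s\<^sup>2)\<close> from \<open>\<rho> / 2\<close> by \<open>\<rho> / 2\<close>.
\<close>

lemma norm_square_minus_half:
  fixes s :: "'a::unital_cstar_algebra"
  assumes s: "adj s = s" and "norm (s * s) \<le> \<rho>"
  shows "norm (s * s - (\<rho>/2) *\<^sub>R 1) \<le> \<rho>/2"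
proof -
  have strict: "norm (s * s - (\<rho>/2) *\<^sub>R 1) \<le> \<rho>/2" if \<rho>: "norm (s * s) < \<rho>" for \<rho>
  proof -
    have pos: "\<rho> > 0" using \<rho> norm_ge_zero[of "s * s"] by linarith
    define t where "t = (1 / sqrt \<rho>) *\<^sub>R s"
    have tt: "t * t = (1/\<rho>) *\<^sub>R (s * s)" using pos by (simp add: t_def)
    have t: "adj t = t" by (simp add: t_def s)
    have "norm (t * t) < 1" using \<rho> pos by (simp add: tt)
    moreover have "adj (t * t) = t * t" by (simp add: adj_mult t)
    moreover have "t * (t * t) = t * t * t" by (simp add: mult.assoc)
    ultimately obtain k where k: "adj k = k" "k * k = 1 - t * t" "t * k = k * t"
      using self_adjoint_sqrt by metis
    define u where "u = t + \<i> *\<^sub>C k"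
    have au: "adj u = t - \<i> *\<^sub>C k"
      by (simp add: u_def adj_add adj_scaleC t k)
    have "adj u * u = 1"
      unfolding au unfolding u_def using k
      by (simp add: algebra_simps mult_scaleC_left mult_scaleC_right scaleC_scaleC)
    then have nu: "norm u = 1" using cstar_identity[of u]
      by (simp add: power2_eq_1_iff) (use norm_ge_zero[of u] in linarith)
    have sum: "u * u + adj u * adj u = 2 *\<^sub>R (2 *\<^sub>R (t * t) - 1)"
      unfolding au unfolding u_def using k
      by (simp add: algebra_simps mult_scaleC_left mult_scaleC_right scaleC_scaleC scaleR_2)
    have "norm (u * u + adj u * adj u) \<le> norm u * norm u + norm (adj u) * norm (adj u)"
      by (metis add_mono norm_mult_ineq norm_triangle_mono)
    then have "norm (2 *\<^sub>R (t * t) - 1) \<le> 1" unfolding sum by (simp add: nu)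
    moreover have "s * s - (\<rho>/2) *\<^sub>R 1 = (\<rho>/2) *\<^sub>R (2 *\<^sub>R (t * t) - 1)"
      using pos by (simp add: tt algebra_simps)
    then have "norm (s * s - (\<rho>/2) *\<^sub>R 1) = (\<rho>/2) * norm (2 *\<^sub>R (t * t) - 1)"
      using pos by simp
    ultimately show ?thesis using pos by simp
  qed
  \<comment> \<open>The square root needs norm below 1, so the boundary case norm (s * s) = \<rho> is a limit.\<close>
  show ?thesis
  proof (rule field_le_epsilon)
    fix e :: real assume e: "e > 0"
    have "norm (s * s - ((\<rho>+e)/2) *\<^sub>R 1) \<le> (\<rho>+e)/2"
      by (rule strict) (use assms e in linarith)
    moreover have "s * s - (\<rho>/2) *\<^sub>R 1 = (s * s - ((\<rho>+e)/2) *\<^sub>R 1) + (e/2) *\<^sub>R 1"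
      by (simp add: algebra_simps add_divide_distrib)
    then have "norm (s * s - (\<rho>/2) *\<^sub>R 1) \<le> norm (s * s - ((\<rho>+e)/2) *\<^sub>R 1) + norm ((e/2) *\<^sub>R (1::'a))"
      by (metis norm_triangle_ineq)
    then have "norm (s * s - (\<rho>/2) *\<^sub>R 1) \<le> norm (s * s - ((\<rho>+e)/2) *\<^sub>R 1) + e/2"
      using e by simp
    ultimately show "norm (s * s - (\<rho>/2) *\<^sub>R 1) \<le> \<rho>/2 + e" by (simp add: add_divide_distrib)
  qed
qed

lemma shifted_self_adjoint_square:
  fixes h :: "'a::unital_cstar_algebra"
  assumes "adj h = h" "norm h < \<tau>"
  obtains k where "adj k = k" "k * k = h + \<tau> *\<^sub>R 1"
proof -
  have pos: "\<tau> > 0" using assms norm_ge_zero[of h] by linarith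
  have "norm (- ((1/\<tau>) *\<^sub>R h)) < 1" using assms pos by simp
  then obtain k where k: "adj k = k" "k * k = 1 - - ((1/\<tau>) *\<^sub>R h)"
    using self_adjoint_sqrt[of "- ((1/\<tau>) *\<^sub>R h)" 1] assms(1) by auto
  show thesis
    by (rule that[of "sqrt \<tau> *\<^sub>R k"]) (use k pos in \<open>simp_all add: algebra_simps\<close>)
qed

text \<open>
  This replaces the statement that the spectral radius \<open>P\<close> of a positive element \<open>p = s\<^sup>2\<close> belongs to
  its spectrum. Suppose \<open>norm (p + \<tau>) \<le> c + \<tau>\<close> with \<open>0 < c < P\<close>. For \<open>\<tau> > 0\<close> the element
  \<open>p + \<tau>\<close> is again a square, so subtracting half of the bound \<open>c + \<tau>\<close> from it gives the same
  inequality with \<open>\<tau>\<close> replaced by \<open>(\<tau> - c) / 2\<close>. Finitely many such steps make the shift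
  nonpositive, and convexity of the norm between the last two shifts then gives
  \<open>norm p \<le> c\<close>, a contradiction.
\<close>

lemma norm_square_plus:
  fixes s :: "'a::unital_cstar_algebra"
  assumes s: "adj s = s" and "\<tau> \<ge> 0"
  shows "norm (s * s + \<tau> *\<^sub>R 1) = norm (s * s) + \<tau>"
proof (rule ccontr)
  define P where "P = norm (s * s)"
  define g where "g \<tau> = norm (s * s + \<tau> *\<^sub>R 1)" for \<tau>
  assume "norm (s * s + \<tau> *\<^sub>R 1) \<noteq> norm (s * s) + \<tau>"
  moreover have "norm (s * s + \<tau> *\<^sub>R 1) \<le> norm (s * s) + \<tau>"
    using norm_triangle_ineq[of "s * s" "\<tau> *\<^sub>R 1"] assms(2) by simp
  ultimately have lt: "g \<tau> < P + \<tau>" by (simp add: g_def P_def)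
  have half: "norm (s * s - (P/2) *\<^sub>R 1) \<le> P/2"
    using norm_square_minus_half[OF s, of P] by (simp add: P_def)
  have P: "P > 0"
  proof (rule ccontr)
    assume "\<not> P > 0"
    then have "s * s = 0" by (simp add: P_def)
    then show False using lt assms(2) by (simp add: g_def P_def)
  qed
  \<comment> \<open>The maximum with P/2 keeps c positive, which makes the shifts drop below 0.\<close>
  define c where "c = max (g \<tau> - \<tau>) (P/2)"
  have c: "0 < c" "c < P" "g \<tau> \<le> c + \<tau>" using lt P by (auto simp: c_def)
  have halve: "g ((\<mu> - c) / 2) \<le> (\<mu> + c) / 2" if \<mu>: "\<mu> > 0" "g \<mu> \<le> c + \<mu>" for \<mu>
  proof -
    have "norm (s * s - (P/2) *\<^sub>R 1) < P/2 + \<mu>" using half \<mu> by linarith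
    then obtain k where k: "adj k = k" "k * k = (s * s - (P/2) *\<^sub>R 1) + (P/2 + \<mu>) *\<^sub>R 1"
      using shifted_self_adjoint_square[of "s * s - (P/2) *\<^sub>R 1" "P/2 + \<mu>"]
      by (auto simp: adj_diff adj_mult s)
    have kk: "k * k = s * s + \<mu> *\<^sub>R 1" using k(2) by (simp add: algebra_simps)
    have "norm (k * k - ((c + \<mu>)/2) *\<^sub>R 1) \<le> (c + \<mu>)/2"
      using norm_square_minus_half[OF k(1), of "c + \<mu>"] \<mu>(2) by (simp add: kk g_def)
    moreover have "k * k - ((c + \<mu>)/2) *\<^sub>R 1 = s * s + ((\<mu> - c)/2) *\<^sub>R 1"
      by (simp add: kk flip: scaleR_add_left scaleR_diff_left add_diff_eq) (simp add: field_simps)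
    ultimately show ?thesis by (simp add: g_def add.commute)
  qed
  have no_shift: False if "0 \<le> \<mu>" "\<mu> \<le> c * 2 ^ n" "g \<mu> \<le> c + \<mu>" for \<mu> n
    using that
  proof (induction n arbitrary: \<mu> )
    case (0 \<mu>)
    have "\<mu> \<noteq> 0" using 0(3) c by (auto simp: g_def P_def)
    with 0(1) have \<mu>: "\<mu> > 0" by simp
    have g': "g ((\<mu> - c) / 2) \<le> (\<mu> + c) / 2" by (rule halve) (use \<mu> 0 in auto)
    \<comment> \<open>Zero is a convex combination of the shifts (\<mu> - c)/2 and \<mu>, with weights
      proportional to 2 \<mu> and c - \<mu>.\<close>
    have "(\<mu> + c) *\<^sub>R (s * s) = (2 * \<mu>) *\<^sub>R (s * s + ((\<mu> - c)/2) *\<^sub>R 1) + (c - \<mu>) *\<^sub>R (s * s + \<mu> *\<^sub>R 1)"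
    proof -
      have "2 * \<mu> * ((\<mu> - c)/2) + (c - \<mu>) * \<mu> = 0" "2 * \<mu> + (c - \<mu>) = \<mu> + c"
        by (simp_all add: field_simps)
      then show ?thesis
        by (simp only: scaleR_add_right scaleR_scaleR add_eq_0_iff scaleR_minus_left flip: scaleR_add_left)
           (simp add: algebra_simps flip: scaleR_2)
    qed
    then have "norm ((\<mu> + c) *\<^sub>R (s * s)) \<le> norm ((2 * \<mu>) *\<^sub>R (s * s + ((\<mu> - c)/2) *\<^sub>R 1)) + norm ((c - \<mu>) *\<^sub>R (s * s + \<mu> *\<^sub>R 1))"
      using norm_triangle_ineq by metis
    then have "(\<mu> + c) * P \<le> 2 * \<mu> * g ((\<mu> - c) / 2) + (c - \<mu>) * g \<mu>"
      using 0 \<mu> c by (simp add: P_def g_def)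
    also have "\<dots> \<le> 2 * \<mu> * ((\<mu> + c) / 2) + (c - \<mu>) * (c + \<mu>)"
      using g' 0 \<mu> by (intro add_mono mult_left_mono) auto
    also have "\<dots> = (\<mu> + c) * c" by (simp add: algebra_simps)
    finally show False using c \<mu> by simp
  next
    case (Suc n \<mu>)
    show False
    proof (cases "\<mu> \<le> c")
      case True
      then show False using Suc c
        by (metis Suc.IH le_add_same_cancel1 less_eq_real_def mult.right_neutral mult_left_mono one_le_power one_le_numeral order_trans)
    next
      case False
      show False
      proof (rule Suc.IH)
        show "g ((\<mu> - c) / 2) \<le> c + (\<mu> - c) / 2"
          using halve[of \<mu>] Suc.prems False c by (simp add: field_simps)
      qed (use False Suc.prems c in \<open>auto simp: field_simps\<close>)
    qed
  qed
  obtain n where n: "\<tau> / c < 2 ^ n"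
    using real_arch_pow[of 2 "\<tau>/c"] by auto
  show False
    by (rule no_shift[of \<tau> n]) (use n c assms(2) in \<open>auto simp: field_simps\<close>)
qed


section \<open>Linear functionals below a sublinear functional\<close>

text \<open>
  Positive homogeneity is demanded as an inequality only; the opposite inequality follows for
  \<open>r > 0\<close> by applying it to \<open>1 / r\<close>.
\<close>

definition sublinear :: "('a::real_vector \<Rightarrow> real) \<Rightarrow> bool" where
  "sublinear q \<longleftrightarrow> (\<forall>x y. q (x + y) \<le> q x + q y) \<and> (\<forall>r\<ge>0. \<forall>x. q (r *\<^sub>R x) \<le> r * q x)"

lemma sublinear_zero: "sublinear q \<Longrightarrow> q 0 = 0"
  unfolding sublinear_def
  by (metis add.right_neutral add_le_same_cancel1 mult_zero_left order_antisym order_refl scale_zero_left le_add_same_cancel1)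

lemma sublinear_uminus: "sublinear q \<Longrightarrow> - q (- x) \<le> q x"
  using sublinear_zero[of q] by (smt (verit) add.right_inverse sublinear_def)

text \<open>
  Completeness of the order for Zorn's lemma. The chain condition is what makes the infimum
  subadditive: of two members, the smaller one bounds both terms. The infimum is finite because
  \<open>- p (- x)\<close> is a lower bound.
\<close>

lemma sublinear_INF_chain:
  assumes C: "C \<noteq> {}" "\<And>q. q \<in> C \<Longrightarrow> sublinear q \<and> q \<le> p"
    and chain: "\<And>q q'. q \<in> C \<Longrightarrow> q' \<in> C \<Longrightarrow> q \<le> q' \<or> q' \<le> q"
  shows "sublinear (\<lambda>x. INF q\<in>C. q x)" and "q \<in> C \<Longrightarrow> (INF q\<in>C. q x) \<le> q x"
proof -
  have bdd: "bdd_below ((\<lambda>q. q x) ` C)" for x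
  proof (rule bdd_belowI2)
    fix q assume "q \<in> C"
    then have "- p (- x) \<le> - q (- x)" "- q (- x) \<le> q x"
      using C(2)[of q] sublinear_uminus by (auto simp: le_fun_def)
    then show "- p (- x) \<le> q x" by linarith
  qed
  define u where "u x = (INF q\<in>C. q x)" for x
  have low: "u x \<le> q x" if "q \<in> C" for q x
    unfolding u_def using bdd that by (rule cINF_lower)
  have great: "m \<le> u x" if "\<And>q. q \<in> C \<Longrightarrow> m \<le> q x" for m x
    unfolding u_def using C(1) that by (rule cINF_greatest)
  have "u (x + y) \<le> u x + u y" for x y
  proof -
    have "u (x + y) \<le> q x + q' y" if q: "q \<in> C" "q' \<in> C" for q q'
      using chain[OF q] low[OF q(1), of "x + y"] low[OF q(2), of "x + y"] C(2)[OF q(1)] C(2)[OF q(2)]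
      unfolding sublinear_def le_fun_def by (smt (verit))
    then have "u (x + y) - q x \<le> u y" if "q \<in> C" for q
      using that by (intro great) (smt (verit))
    then have "u (x + y) - u y \<le> u x" by (intro great) (smt (verit))
    then show ?thesis by simp
  qed
  moreover have "u (r *\<^sub>R x) \<le> r * u x" if r: "r \<ge> 0" for r x
  proof (cases "r = 0")
    case True
    obtain q where "q \<in> C" using C(1) by blast
    then show ?thesis using low[of q 0] C(2)[of q] sublinear_zero[of q] True by simp
  next
    case False
    have "u (r *\<^sub>R x) / r \<le> u x"
    proof (rule great)
      fix q assume q: "q \<in> C"
      have "u (r *\<^sub>R x) \<le> r * q x"
        using low[OF q] C(2)[OF q] r unfolding sublinear_def by (meson order_trans)
      then show "u (r *\<^sub>R x) / r \<le> q x" using False r by (simp add: field_simps)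
    qed
    then show ?thesis using False r by (simp add: field_simps)
  qed
  ultimately show "sublinear (\<lambda>x. INF q\<in>C. q x)" by (simp add: sublinear_def u_def)
  show "(INF q\<in>C. q x) \<le> q x" if "q \<in> C" using low[OF that] by (simp add: u_def)
qed

text \<open>
  The infimum over \<open>t \<ge> 0\<close> of \<open>q (x + t y) - t q y\<close> is the largest functional with these three
  properties. A linear functional below it must agree with \<open>q\<close> at \<open>y\<close>.
\<close>

lemma sublinear_attaining:
  assumes q: "sublinear q"
  obtains q' where "sublinear q'" "q' \<le> q" "q' (- y) \<le> - q y"
proof -
  define q' where "q' x = (INF t\<in>{0..}. q (x + t *\<^sub>R y) - t * q y)" for x
  have hom: "t * q y \<le> q (t *\<^sub>R y)" if "t \<ge> 0" for t
  proof (cases "t = 0")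
    case True then show ?thesis using sublinear_zero[OF q] by simp
  next
    case False
    have "q ((1/t) *\<^sub>R (t *\<^sub>R y)) \<le> (1/t) * q (t *\<^sub>R y)"
      using q that unfolding sublinear_def by (metis divide_nonneg_nonneg zero_le_one)
    then show ?thesis using False that by (simp add: field_simps)
  qed
  have bdd: "bdd_below ((\<lambda>t. q (x + t *\<^sub>R y) - t * q y) ` {0..})" for x
  proof (rule bdd_belowI2)
    fix t :: real assume "t \<in> {0..}"
    moreover have "q ((x + t *\<^sub>R y) + - x) \<le> q (x + t *\<^sub>R y) + q (- x)"
      using q unfolding sublinear_def by blast
    ultimately show "- q (- x) \<le> q (x + t *\<^sub>R y) - t * q y" using hom[of t] by simp
  qed
  have low: "q' x \<le> q (x + t *\<^sub>R y) - t * q y" if "t \<ge> 0" for t x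
    unfolding q'_def by (rule cINF_lower[OF bdd]) (use that in simp)
  have great: "m \<le> q' x" if "\<And>t. t \<ge> 0 \<Longrightarrow> m \<le> q (x + t *\<^sub>R y) - t * q y" for m x
    unfolding q'_def using that by (intro cINF_greatest) auto
  have "q' (x + z) \<le> q' x + q' z" for x z
  proof -
    have "q' (x + z) \<le> (q (x + s *\<^sub>R y) - s * q y) + (q (z + t *\<^sub>R y) - t * q y)"
      if "s \<ge> 0" "t \<ge> 0" for s t
    proof -
      have "q ((x + s *\<^sub>R y) + (z + t *\<^sub>R y)) \<le> q (x + s *\<^sub>R y) + q (z + t *\<^sub>R y)"
        using q unfolding sublinear_def by blast
      moreover have "(x + s *\<^sub>R y) + (z + t *\<^sub>R y) = (x + z) + (s + t) *\<^sub>R y"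
        by (simp add: algebra_simps)
      ultimately show ?thesis using low[of "s + t" "x + z"] that by (simp add: algebra_simps)
    qed
    then have "q' (x + z) - (q (x + s *\<^sub>R y) - s * q y) \<le> q' z" if "s \<ge> 0" for s
      using that by (intro great) (smt (verit))
    then have "q' (x + z) - q' z \<le> q' x" by (intro great) (smt (verit))
    then show ?thesis by simp
  qed
  moreover have "q' (r *\<^sub>R x) \<le> r * q' x" if r: "r \<ge> 0" for r x
  proof (cases "r = 0")
    case True
    then show ?thesis using low[of 0 0] sublinear_zero[OF q] by simp
  next
    case False
    have "q' (r *\<^sub>R x) / r \<le> q' x"
    proof (rule great)
      fix t :: real assume t: "t \<ge> 0"
      have "q (r *\<^sub>R (x + t *\<^sub>R y)) \<le> r * q (x + t *\<^sub>R y)"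
        using q r unfolding sublinear_def by blast
      then have "q' (r *\<^sub>R x) \<le> r * (q (x + t *\<^sub>R y) - t * q y)"
        using low[of "r * t" "r *\<^sub>R x"] r t by (simp add: algebra_simps)
      then show "q' (r *\<^sub>R x) / r \<le> q (x + t *\<^sub>R y) - t * q y"
        using False r by (simp add: divide_le_eq mult.commute)
    qed
    then show ?thesis using False r by (simp add: field_simps)
  qed
  ultimately have "sublinear q'" by (simp add: sublinear_def)
  moreover have "q' \<le> q" using low[of 0] by (simp add: le_fun_def)
  moreover have "q' (- y) \<le> - q y" using low[of 1 "- y"] sublinear_zero[OF q] by simp
  ultimately show thesis by (rule that)
qed

text \<open>
  Minimality forces \<open>q (- z) = - q z\<close> for all \<open>z\<close>, by the preceding lemma, and a sublinear
  functional that is odd is linear.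
\<close>

lemma minimal_sublinear_linear:
  assumes q: "sublinear q" and min: "\<And>q'. sublinear q' \<Longrightarrow> q' \<le> q \<Longrightarrow> q' = q"
  shows "linear q"
proof -
  have neg: "q (- z) = - q z" for z
  proof -
    obtain q' where "sublinear q'" "q' \<le> q" "q' (- z) \<le> - q z"
      using sublinear_attaining[OF q] by metis
    then show ?thesis using min[of q'] sublinear_uminus[OF q, of z] by force
  qed
  have hom: "q (r *\<^sub>R x) = r * q x" if "r \<ge> 0" for r x
  proof -
    have "q (r *\<^sub>R x) \<le> r * q x" "q (r *\<^sub>R (- x)) \<le> r * q (- x)"
      using q that unfolding sublinear_def by blast+
    then show ?thesis by (simp add: neg)
  qed
  show ?thesis
  proof (rule linearI)
    fix x z
    have "q (x + z) \<le> q x + q z" "q (- x + - z) \<le> q (- x) + q (- z)"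
      using q unfolding sublinear_def by blast+
    moreover have "q (- x + - z) = - q (x + z)" using neg[of "x + z"] by simp
    ultimately show "q (x + z) = q x + q z" by (simp add: neg)
  next
    fix r x
    show "q (r *\<^sub>R x) = r *\<^sub>R q x"
      using hom[of r x] hom[of "- r" x] neg[of "r *\<^sub>R x"] by (cases "r \<ge> 0") auto
  qed
qed

text \<open>
  The Hahn-Banach theorem with prescribed contact at \<open>y\<close>, obtained by choosing a minimal element
  among all sublinear functionals instead of extending a functional from subspaces.
\<close>

lemma linear_below_sublinear:
  assumes p: "sublinear p"
  obtains f where "linear f" "\<And>x. f x \<le> p x" "f y = p y"
proof -
  obtain p' where p': "sublinear p'" "p' \<le> p" "p' (- y) \<le> - p y"
    using sublinear_attaining[OF p] by metis
  define A where "A = {q. sublinear q \<and> q \<le> p'}"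
  have "\<exists>m\<in>A. \<forall>a\<in>A. a \<le> m \<longrightarrow> a = m"
  proof (rule predicate_Zorn)
    show "partial_order_on A (relation_of (\<lambda>a b. b \<le> a) A)"
      by (rule partial_order_on_relation_ofI) auto
  next
    fix C assume "C \<in> Chains (relation_of (\<lambda>a b. b \<le> a) A)"
    then have CA: "C \<subseteq> A" and ch: "\<And>q q'. q \<in> C \<Longrightarrow> q' \<in> C \<Longrightarrow> q \<le> q' \<or> q' \<le> q"
      by (auto simp: Chains_def relation_of_def)
    show "\<exists>u\<in>A. \<forall>a\<in>C. u \<le> a"
    proof (cases "C = {}")
      case True
      then show ?thesis using p' by (auto simp: A_def)
    next
      case False
      have sub: "sublinear q \<and> q \<le> p'" if "q \<in> C" for q using CA that by (auto simp: A_def)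
      let ?u = "\<lambda>x. INF q\<in>C. q x"
      have low: "?u \<le> q" if "q \<in> C" for q
        using sublinear_INF_chain(2)[OF False sub ch that] by (simp add: le_fun_def)
      moreover have "?u \<in> A"
        using sublinear_INF_chain(1)[OF False sub ch] False low sub
        unfolding A_def by (blast intro: order_trans)
      ultimately show ?thesis by blast
    qed
  qed
  then obtain f where f: "f \<in> A" "\<And>q. q \<in> A \<Longrightarrow> q \<le> f \<Longrightarrow> q = f" by blast
  have "linear f"
    by (rule minimal_sublinear_linear) (use f in \<open>auto simp: A_def intro: order_trans\<close>)
  moreover have le: "f x \<le> p x" for x
    using f(1) p'(2) by (auto simp: A_def le_fun_def intro: order_trans)
  moreover have "f (- y) \<le> - p y"
    using f(1) p'(3) by (auto simp: A_def le_fun_def intro: order_trans)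
  then have "f y = p y" using le[of y] linear_neg[OF \<open>linear f\<close>, of y] by simp
  ultimately show thesis by (rule that)
qed

section \<open>States and self-adjoint elements\<close>

lemma state_linear:
  assumes "\<phi> \<in> state_space"
  shows "\<phi> (x + y) = \<phi> x + \<phi> y" "\<phi> (x - y) = \<phi> x - \<phi> y" "\<phi> (- x) = - \<phi> x"
    "\<phi> (c *\<^sub>C x) = c * \<phi> x" "\<phi> (r *\<^sub>R x) = of_real r * \<phi> x" "\<phi> 1 = 1"
proof -
  interpret Vector_Spaces.linear scaleC "(*)" \<phi> using assms by (simp add: state_space_def)
  show "\<phi> (x + y) = \<phi> x + \<phi> y" "\<phi> (x - y) = \<phi> x - \<phi> y" "\<phi> (- x) = - \<phi> x"
    "\<phi> (c *\<^sub>C x) = c * \<phi> x" by (rule add diff neg scale)+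
  show "\<phi> (r *\<^sub>R x) = of_real r * \<phi> x" using scale[of "of_real r" x] by (simp add: scaleC_of_real)
  show "\<phi> 1 = 1" using assms by (simp add: state_space_def)
qed

lemma state_bound: "\<phi> \<in> state_space \<Longrightarrow> cmod (\<phi> x) \<le> norm x"
  by (simp add: state_space_def)

text \<open>
  The usual complexification \<open>x \<mapsto> f x - \<i> f (\<i> x)\<close>. Contractivity follows by rotating \<open>\<phi> x\<close> to
  the positive axis; and \<open>\<phi> 1\<close> has modulus at most 1 and real part 1, so it equals 1.
\<close>

lemma state_of_real_functional:
  fixes f :: "'a::unital_cstar_algebra \<Rightarrow> real"
  assumes f: "linear f" "\<And>x. f x \<le> norm x" "f 1 = 1"
  obtains \<phi> where "\<phi> \<in> state_space" "\<And>x. Re (\<phi> x) = f x"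
proof -
  define \<phi> where "\<phi> x = Complex (f x) (- f (\<i> *\<^sub>C x))" for x
  have decomp: "c *\<^sub>C x = Re c *\<^sub>R x + Im c *\<^sub>R (\<i> *\<^sub>C x)" for c and x :: 'a
    by (metis complex_eq mult.commute scaleC_add_left scaleC_of_real scaleC_scaleC)
  have ii: "\<i> *\<^sub>C \<i> *\<^sub>C x = - x" for x :: 'a
    by (simp add: scaleC_scaleC)
  have hom: "\<phi> (c *\<^sub>C x) = c * \<phi> x" for c x
  proof -
    have "f (c *\<^sub>C x) = Re c * f x + Im c * f (\<i> *\<^sub>C x)"
      using f(1) by (subst decomp) (simp add: linear_add linear_cmul)
    moreover have "f (\<i> *\<^sub>C c *\<^sub>C x) = Re c * f (\<i> *\<^sub>C x) - Im c * f x"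
    proof -
      have "\<i> *\<^sub>C c *\<^sub>C x = c *\<^sub>C \<i> *\<^sub>C x" by (simp add: scaleC_scaleC mult.commute)
      also have "\<dots> = Re c *\<^sub>R (\<i> *\<^sub>C x) + Im c *\<^sub>R (- x)" by (subst decomp) (simp add: ii)
      finally show ?thesis using f(1) by (simp add: linear_add linear_cmul linear_diff)
    qed
    ultimately show ?thesis by (simp add: \<phi>_def complex_eq_iff algebra_simps)
  qed
  have "Vector_Spaces.linear scaleC (*) \<phi>"
  proof (unfold_locales)
    show "\<phi> (x + y) = \<phi> x + \<phi> y" for x y
      using f(1) by (simp add: \<phi>_def complex_eq_iff scaleC_add_right linear_add)
  qed (simp_all add: hom algebra_simps)
  moreover have bound: "cmod (\<phi> x) \<le> norm x" for x
  proof (cases "\<phi> x = 0")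
    case False
    define c where "c = cnj (sgn (\<phi> x))"
    have "\<phi> (c *\<^sub>C x) = of_real (cmod (\<phi> x))"
      unfolding hom c_def by (simp add: sgn_eq complex_norm_square[symmetric] power2_eq_square mult.commute)
    then have "cmod (\<phi> x) = f (c *\<^sub>C x)" by (simp add: \<phi>_def complex_eq_iff)
    also have "\<dots> \<le> norm x" using f(2)[of "c *\<^sub>C x"] False by (simp add: norm_scaleC c_def norm_sgn)
    finally show ?thesis .
  qed simp
  moreover have "\<phi> 1 = 1"
  proof -
    have "cmod (\<phi> 1) \<le> 1" using bound[of 1] by simp
    then have "(cmod (\<phi> 1))\<^sup>2 \<le> 1" by (simp add: power_le_one)
    then have "(f (\<i> *\<^sub>C 1))\<^sup>2 \<le> 0" unfolding cmod_power2 by (simp add: \<phi>_def f(3))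
    then show ?thesis by (simp add: \<phi>_def f(3) complex_eq_iff)
  qed
  ultimately have "\<phi> \<in> state_space" by (simp add: state_space_def)
  then show thesis by (rule that) (simp add: \<phi>_def)
qed

text \<open>
  A real functional below the norm that attains it at \<open>s\<^sup>2 + 1\<close>, whose norm is
  \<open>norm (s\<^sup>2) + 1\<close>, is forced to attain it at both summands.
\<close>

lemma exists_state_attaining_norm_of_square:
  fixes s :: "'a::unital_cstar_algebra"
  assumes s: "adj s = s"
  obtains \<phi> where "\<phi> \<in> state_space" "Re (\<phi> (s * s)) = norm (s * s)"
proof -
  have "sublinear (norm :: 'a \<Rightarrow> real)" by (simp add: sublinear_def norm_triangle_ineq)
  then obtain f where f: "linear f" "\<And>x::'a. f x \<le> norm x" "f (s * s + 1) = norm (s * s + 1)"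
    using linear_below_sublinear by metis
  have "f (s * s) + f 1 = norm (s * s) + 1"
    using f(3) norm_square_plus[OF s, of 1] by (simp add: linear_add[OF f(1)])
  then have "f 1 = 1" "f (s * s) = norm (s * s)" using f(2)[of 1] f(2)[of "s * s"] by auto
  then show thesis using state_of_real_functional[OF f(1,2)] that by metis
qed

text \<open>
  If \<open>\<phi> h\<close> has imaginary part \<open>\<beta>\<close>, then \<open>\<phi> (h + \<i> t)\<close> has imaginary part \<open>\<beta> + t\<close>, while
  the norm of \<open>h + \<i> t\<close> is at most the square root of \<open>norm h\<^sup>2 + t\<^sup>2\<close>; for \<open>\<beta> \<noteq> 0\<close> this fails
  for some real \<open>t\<close>.
\<close>

lemma state_self_adjoint_real:
  assumes \<phi>: "\<phi> \<in> state_space" and h: "adj h = h"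
  shows "Im (\<phi> h) = 0"
proof (rule ccontr)
  define \<beta> where "\<beta> = Im (\<phi> h)"
  assume "Im (\<phi> h) \<noteq> 0"
  then have \<beta>: "\<beta> \<noteq> 0" by (simp add: \<beta>_def)
  have le: "(\<beta> + t)\<^sup>2 \<le> (norm h)\<^sup>2 + t\<^sup>2" for t
  proof -
    define z where "z = h + (of_real t * \<i>) *\<^sub>C 1"
    have "(\<beta> + t)\<^sup>2 \<le> (cmod (\<phi> z))\<^sup>2"
      unfolding cmod_power2 by (simp add: z_def \<beta>_def state_linear[OF \<phi>])
    also have "\<dots> \<le> (norm z)\<^sup>2" using state_bound[OF \<phi>] by (simp add: power_mono)
    also have "\<dots> = norm (adj z * z)" by (simp add: cstar_identity)
    also have "adj z * z = h * h + t\<^sup>2 *\<^sub>R 1"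
    proof -
      have az: "adj z = h - (of_real t * \<i>) *\<^sub>C 1" by (simp add: z_def adj_add adj_scaleC h)
      have "t\<^sup>2 *\<^sub>R (1::'a) = (of_real t * of_real t) *\<^sub>C 1"
        by (simp add: power2_eq_square flip: scaleC_of_real of_real_mult)
      then show ?thesis
        unfolding az unfolding z_def
        by (simp add: algebra_simps mult_scaleC_left mult_scaleC_right scaleC_scaleC)
    qed
    also have "norm (h * h + t\<^sup>2 *\<^sub>R 1) \<le> (norm h)\<^sup>2 + t\<^sup>2"
      using norm_triangle_ineq[of "h * h" "t\<^sup>2 *\<^sub>R 1"] norm_square_self_adjoint[OF h] by simp
    finally show ?thesis .
  qed
  show False
    using le[of "((norm h)\<^sup>2 + 1) / (2 * \<beta>)"] \<beta> by (simp add: power2_sum) (use zero_le_power2[of \<beta>] in linarith)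
qed

lemma state_square_nonneg:
  assumes \<phi>: "\<phi> \<in> state_space" and h: "adj h = h"
  shows "0 \<le> Re (\<phi> (h * h))"
proof -
  define \<rho> where "\<rho> = norm (h * h)"
  have "cmod (\<phi> (h * h - (\<rho>/2) *\<^sub>R 1)) \<le> \<rho>/2"
    using state_bound[OF \<phi>] norm_square_minus_half[OF h, of \<rho>] by (metis \<rho>_def order_refl order_trans)
  then have "\<bar>Re (\<phi> (h * h)) - \<rho>/2\<bar> \<le> \<rho>/2"
    using abs_Re_le_cmod[of "\<phi> (h * h - (\<rho>/2) *\<^sub>R 1)"] by (simp add: state_linear[OF \<phi>])
  then show ?thesis by linarith
qed

text \<open>
  States determine the norm of self-adjoint elements. Let \<open>P = norm h\<close> and \<open>\<tau> > P\<close>. Then \<open>\<tau> + h\<close> and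
  \<open>\<tau> - h\<close> are squares of norm at most \<open>\<tau> + C\<close>, since states attain the norm of a square.
  Removing half of that bound gives \<open>norm (h \<plusminus> \<mu>) \<le> C + \<mu>\<close> for \<open>\<mu> = (\<tau> - C) / 2\<close>. As
  \<open>h\<^sup>2 + \<mu>\<^sup>2\<close> is the average of the squares of \<open>h + \<mu>\<close> and \<open>h - \<mu>\<close> and has norm \<open>P\<^sup>2 + \<mu>\<^sup>2\<close>, it follows that
  \<open>P\<^sup>2 \<le> C\<^sup>2 + 2 C \<mu> = C \<tau>\<close>; let \<open>\<tau>\<close> tend to \<open>P\<close>.
\<close>

lemma norm_self_adjoint_le:
  fixes h :: "'a::unital_cstar_algebra"
  assumes h: "adj h = h" and C: "\<And>\<phi>. \<phi> \<in> state_space \<Longrightarrow> \<bar>Re (\<phi> h)\<bar> \<le> C"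
  shows "norm h \<le> C"
proof (rule ccontr)
  define P where "P = norm h"
  assume "\<not> norm h \<le> C"
  then have CP: "C < P" by (simp add: P_def)
  have half: "norm (g + ((\<tau> - C)/2) *\<^sub>R 1) \<le> C + (\<tau> - C)/2"
    if g: "adj g = g" "norm g < \<tau>" "\<And>\<phi>. \<phi> \<in> state_space \<Longrightarrow> Re (\<phi> g) \<le> C" for g :: 'a and \<tau>
  proof -
    obtain k where k: "adj k = k" "k * k = g + \<tau> *\<^sub>R 1"
      using shifted_self_adjoint_square[OF g(1,2)] .
    obtain \<phi> where \<phi>: "\<phi> \<in> state_space" "Re (\<phi> (k * k)) = norm (k * k)"
      using exists_state_attaining_norm_of_square[OF k(1)] .
    have "norm (k * k) \<le> C + \<tau>" using \<phi> g(3)[OF \<phi>(1)] by (simp add: k state_linear)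
    then have "norm (k * k - ((C + \<tau>)/2) *\<^sub>R 1) \<le> (C + \<tau>)/2"
      by (rule norm_square_minus_half[OF k(1)])
    moreover have "\<tau> - (C + \<tau>)/2 = (\<tau> - C)/2" by (simp add: field_simps)
    then have "k * k - ((C + \<tau>)/2) *\<^sub>R 1 = g + ((\<tau> - C)/2) *\<^sub>R 1"
      by (simp add: k add_diff_eq[symmetric] flip: scaleR_diff_left)
    ultimately show ?thesis by (simp add: field_simps)
  qed
  have le: "P\<^sup>2 \<le> C * \<tau>" if \<tau>: "P < \<tau>" for \<tau>
  proof -
    define \<mu> where "\<mu> = (\<tau> - C)/2"
    have plus: "norm (h + \<mu> *\<^sub>R 1) \<le> C + \<mu>"
      unfolding \<mu>_def by (rule half) (use h \<tau> C in \<open>auto simp: P_def abs_le_iff\<close>)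
    have "norm (- h + \<mu> *\<^sub>R 1) \<le> C + \<mu>"
      unfolding \<mu>_def by (rule half) (use h \<tau> C in \<open>auto simp: P_def abs_le_iff state_linear\<close>)
    then have minus: "norm (h - \<mu> *\<^sub>R 1) \<le> C + \<mu>" by (simp add: norm_minus_commute)
    have "P\<^sup>2 + \<mu>\<^sup>2 = norm (h * h + \<mu>\<^sup>2 *\<^sub>R 1)"
      using norm_square_plus[OF h, of "\<mu>\<^sup>2"] norm_square_self_adjoint[OF h] by (simp add: P_def)
    also have "2 * \<dots> = norm ((h + \<mu> *\<^sub>R 1) * (h + \<mu> *\<^sub>R 1) + (h - \<mu> *\<^sub>R 1) * (h - \<mu> *\<^sub>R 1))"
    proof -
      have "(h + \<mu> *\<^sub>R 1) * (h + \<mu> *\<^sub>R 1) + (h - \<mu> *\<^sub>R 1) * (h - \<mu> *\<^sub>R 1) = 2 *\<^sub>R (h * h + \<mu>\<^sup>2 *\<^sub>R 1)"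
        by (simp add: algebra_simps power2_eq_square scaleR_2) (simp flip: scaleR_add_left)
      then show ?thesis by simp
    qed
    also have "\<dots> \<le> norm (h + \<mu> *\<^sub>R 1) * norm (h + \<mu> *\<^sub>R 1) + norm (h - \<mu> *\<^sub>R 1) * norm (h - \<mu> *\<^sub>R 1)"
      by (metis add_mono norm_mult_ineq norm_triangle_mono)
    also have "\<dots> \<le> (C + \<mu>) * (C + \<mu>) + (C + \<mu>) * (C + \<mu>)"
      using plus minus order_trans[OF norm_ge_zero plus] by (intro add_mono mult_mono) simp_all
    finally have "P\<^sup>2 \<le> C * (C + 2 * \<mu>)" by (simp add: power2_eq_square algebra_simps)
    moreover have "C + 2 * \<mu> = \<tau>" by (simp add: \<mu>_def field_simps)
    ultimately show ?thesis by simp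
  qed
  have "C \<ge> 0"
  proof -
    obtain \<phi> :: "'a \<Rightarrow> complex" where "\<phi> \<in> state_space"
      using exists_state_attaining_norm_of_square[of 1] by auto
    then show ?thesis using C[of \<phi>] by linarith
  qed
  show False
  proof (cases "C = 0")
    case True
    then show False using le[of "P + 1"] CP by simp
  next
    case False
    then have pos: "C > 0" "P > 0" using \<open>C \<ge> 0\<close> CP by auto
    have "P < P\<^sup>2 / C" using pos CP by (simp add: power2_eq_square field_simps)
    then obtain \<tau> where "P < \<tau>" "\<tau> < P\<^sup>2 / C" using dense by blast
    then show False using le[of \<tau>] pos by (simp add: field_simps)
  qed
qed

section \<open>Positivity of states\<close>

lemma norm_mult_le_one:
  "norm x \<le> 1 \<Longrightarrow> norm y \<le> 1 \<Longrightarrow> norm (x * y) \<le> (1::real)" for x y :: "'a::real_normed_algebra"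
  using norm_mult_ineq[of x y] mult_le_one[of "norm x" "norm y"] by simp

lemma state_Re_bound: "\<phi> \<in> state_space \<Longrightarrow> norm x \<le> 1 \<Longrightarrow> \<bar>Re (\<phi> x)\<bar> \<le> 1"
  using abs_Re_le_cmod[of "\<phi> x"] state_bound[of \<phi> x] by linarith

text \<open>
  A state taking the extreme value \<open>-1\<close> at a self-adjoint contraction \<open>h\<close> evaluates powers of
  \<open>h\<close> as if \<open>h\<close> were \<open>-1\<close>. Here this is needed up to the third power: nonnegativity at
  \<open>(1 + h)\<^sup>2\<close> settles \<open>h\<^sup>2\<close>, and nonnegativity at \<open>(1 + h - e h\<^sup>2)\<^sup>2\<close>, with \<open>e\<close> the defect of the
  third moment, settles \<open>h\<^sup>3\<close>.
\<close>

lemma state_cubic_at_minus_one: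
  assumes \<phi>: "\<phi> \<in> state_space" and h: "adj h = h" "norm h \<le> 1" "Re (\<phi> h) = - 1"
  shows "Re (\<phi> ((1 - h) * h * (1 - h))) = - 4"
proof -
  define m where "m n = Re (\<phi> (h ^ n))" for n
  have "norm (h ^ n) \<le> 1" for n
    by (rule order_trans[OF norm_power_ineq]) (simp add: h power_le_one)
  then have m: "\<bar>m n\<bar> \<le> 1" for n unfolding m_def by (rule state_Re_bound[OF \<phi>])
  have "0 \<le> Re (\<phi> ((1 + h) * (1 + h)))"
    by (rule state_square_nonneg[OF \<phi>]) (simp add: adj_add h)
  moreover have "(1 + h) * (1 + h) = 1 + 2 *\<^sub>R h + h ^ 2"
    by (simp add: algebra_simps scaleR_2 power2_eq_square)
  ultimately have m2: "m 2 = 1" using m[of 2] h(3)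
    by (simp add: state_linear[OF \<phi>] m_def)
  define e where "e = 1 + m 3"
  have "0 \<le> Re (\<phi> ((1 + h - e *\<^sub>R h ^ 2) * (1 + h - e *\<^sub>R h ^ 2)))"
    by (rule state_square_nonneg[OF \<phi>]) (simp add: adj_add adj_diff adj_mult h power2_eq_square)
  moreover have "(1 + h - e *\<^sub>R h ^ 2) * (1 + h - e *\<^sub>R h ^ 2)
      = 1 + 2 *\<^sub>R h + h ^ 2 - (2 * e) *\<^sub>R (h ^ 2) - (2 * e) *\<^sub>R (h ^ 3) + (e * e) *\<^sub>R (h ^ 4)"
    by (simp add: algebra_simps power2_eq_square eval_nat_numeral flip: scaleR_2)
  ultimately have "0 \<le> - 1 + m 2 - 2 * e * m 2 - 2 * e * m 3 + e * e * m 4"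
    using h(3) by (simp add: state_linear[OF \<phi>] m_def)
  then have "e * e * 2 \<le> e * e * m 4" by (simp add: m2 e_def algebra_simps)
  moreover have "e * e * m 4 \<le> e * e * 1" using m[of 4] by (intro mult_left_mono) auto
  ultimately have "e = 0" using zero_le_square[of e] by (smt (verit) mult_eq_0_iff)
  moreover have "(1 - h) * h * (1 - h) = h - 2 *\<^sub>R h ^ 2 + h ^ 3"
    by (simp add: algebra_simps scaleR_2 eval_nat_numeral)
  ultimately show ?thesis using m2 h(3) by (simp add: state_linear[OF \<phi>] m_def e_def)
qed

text \<open>
  The fragment of \<open>x\<^sup>* x \<ge> 0\<close> that peak sets require. Let \<open>a = x\<^sup>* x\<close> with \<open>\<psi> a = -1\<close>.
  Replacing \<open>x\<close> by \<open>y = x (1 - a) / 2\<close> turns \<open>a\<close> into \<open>b = a (1 - a)\<^sup>2 / 4\<close>, which still has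
  \<open>\<psi> b = -1\<close> but whose values under states are at most \<open>1/2\<close>. Because \<open>b + c\<close>, for \<open>c = y y\<^sup>*\<close>, is half a sum of two
  squares of self-adjoint elements, states are at least \<open>-1/2\<close> on \<open>c\<close>. Yet \<open>b\<close> and \<open>c\<close> should have the same nonzero
  spectrum; what is used of this is that \<open>b (1 - b)\<^sup>2\<close> and \<open>c (1 - c)\<^sup>2\<close> have equal norm, since
  \<open>y (1 - b) = (1 - c) y\<close>. The first norm is at least \<open>4\<close>, by evaluating \<open>\<psi>\<close>, and the
  second is at most \<open>1/2 + 2 + 1 = 7/2\<close>, as all states are bounded by that on it.
\<close>

lemma state_ne_minus_one:
  assumes \<psi>: "\<psi> \<in> state_space" and x: "norm x \<le> 1"
  shows "\<psi> (adj x * x) \<noteq> - 1"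
proof
  define cubic where "cubic h = (1 - h) * h * (1 - h)" for h :: 'a
  define a where "a = adj x * x"
  assume "\<psi> (adj x * x) = - 1"
  then have \<psi>a: "Re (\<psi> a) = - 1" by (simp add: a_def)
  have a: "adj a = a" by (simp add: a_def adj_mult adj_adj)
  have na: "norm a \<le> 1" using x by (simp add: a_def norm_mult_le_one)
  define y where "y = (1/2) *\<^sub>R (x * (1 - a))"
  have "norm (x * (1 - a)) \<le> norm x * norm (1 - a)" by (rule norm_mult_ineq)
  also have "\<dots> \<le> 1 * 2"
    using x na norm_triangle_ineq4[of 1 a] by (intro mult_mono) auto
  finally have ny: "norm y \<le> 1" by (simp add: y_def)
  define b where "b = adj y * y"
  define c where "c = y * adj y"
  have b: "adj b = b" "norm b \<le> 1" and c: "adj c = c" "norm c \<le> 1"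
    using ny by (simp_all add: b_def c_def adj_mult adj_adj norm_mult_le_one)
  have b_cubic: "b = (1/4) *\<^sub>R cubic a"
    by (simp add: b_def y_def adj_mult adj_diff a cubic_def) (simp add: a_def mult.assoc)
  have cubic: "cubic h = h - 2 *\<^sub>R (h * h) + h * h * h" for h
    by (simp add: cubic_def algebra_simps scaleR_2)
  have "Re (\<psi> b) = - 1"
    using state_cubic_at_minus_one[OF \<psi> a na \<psi>a] by (simp add: b_cubic state_linear[OF \<psi>] cubic_def)
  then have "Re (\<psi> (cubic b)) = - 4"
    unfolding cubic_def by (rule state_cubic_at_minus_one[OF \<psi> b])
  then have "4 \<le> norm (cubic b)"
    using abs_Re_le_cmod[of "\<psi> (cubic b)"] state_bound[OF \<psi>, of "cubic b"] by linarith
  also have "norm (cubic b) = (norm (y * (1 - b)))\<^sup>2"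
    by (simp add: cubic_def b adj_mult adj_diff flip: cstar_identity) (simp add: b_def mult.assoc)
  also have "y * (1 - b) = (1 - c) * y"
    by (simp add: b_def c_def algebra_simps)
  also have "(norm ((1 - c) * y))\<^sup>2 = norm (cubic c)"
    by (simp add: cubic_def c adj_mult adj_diff flip: cstar_identity') (simp add: c_def mult.assoc)
  also have "norm (cubic c) \<le> 7/2"
  proof (rule norm_self_adjoint_le)
    show "adj (cubic c) = cubic c" by (simp add: cubic_def c adj_mult adj_diff mult.assoc)
    fix \<phi> :: "'a \<Rightarrow> complex" assume \<phi>: "\<phi> \<in> state_space"
    have cube: "\<bar>Re (\<phi> (h * h * h))\<bar> \<le> 1" "0 \<le> Re (\<phi> (h * h))" "Re (\<phi> (h * h)) \<le> 1" "\<bar>Re (\<phi> h)\<bar> \<le> 1"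
      if h: "adj h = h" "norm h \<le> 1" for h
      using state_Re_bound[OF \<phi>, of "h * h * h"] state_Re_bound[OF \<phi>, of "h * h"]
        state_Re_bound[OF \<phi>, of h] state_square_nonneg[OF \<phi> h(1)] h(2)
      by (auto simp: norm_mult_le_one)
    have "Re (\<phi> b) \<le> 1/2"
      using cube[OF a na] by (simp add: b_cubic cubic state_linear[OF \<phi>])
    moreover have "0 \<le> Re (\<phi> (b + c))"
    proof -
      have "0 \<le> Re (\<phi> ((y + adj y) * (y + adj y)))"
        by (rule state_square_nonneg[OF \<phi>]) (simp add: adj_add adj_adj add.commute)
      moreover have "0 \<le> Re (\<phi> ((\<i> *\<^sub>C (y - adj y)) * (\<i> *\<^sub>C (y - adj y))))"
        by (rule state_square_nonneg[OF \<phi>])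
          (simp add: adj_scaleC adj_diff adj_adj complex_vector.scale_right_diff_distrib)
      \<comment> \<open>The two elements squared are 2 and -2 times the real and imaginary parts of y.\<close>
      moreover have "(y + adj y) * (y + adj y) + (\<i> *\<^sub>C (y - adj y)) * (\<i> *\<^sub>C (y - adj y)) = 2 *\<^sub>R (b + c)"
        by (simp add: mult_scaleC_left mult_scaleC_right scaleC_scaleC b_def c_def algebra_simps scaleR_2)
      ultimately show ?thesis
        by (metis (no_types, lifting) add_nonneg_nonneg plus_complex.sel(1) state_linear(1)[OF \<phi>] scaleR_2 mult_2 zero_le_double_add_iff_zero_le_single_add)
    qed
    ultimately have "- 1/2 \<le> Re (\<phi> c)" by (simp add: state_linear[OF \<phi>])
    moreover have "Re (\<phi> (cubic c)) = Re (\<phi> c) - 2 * Re (\<phi> (c * c)) + Re (\<phi> (c * c * c))"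
      by (simp add: cubic state_linear[OF \<phi>])
    ultimately show "\<bar>Re (\<phi> (cubic c))\<bar> \<le> 7/2"
      using cube[OF c] by linarith
  qed
  finally show False by simp
qed

lemma state_less_one_off_N_Q:
  assumes \<psi>: "\<psi> \<in> state_space" and x: "norm x = 1" and ne: "\<psi> (adj x * x) \<noteq> 1"
  shows "cmod (\<psi> (adj x * x)) < 1"
proof -
  have "Im (\<psi> (adj x * x)) = 0"
    by (rule state_self_adjoint_real[OF \<psi>]) (simp add: adj_mult adj_adj)
  then have real: "\<psi> (adj x * x) = of_real (Re (\<psi> (adj x * x)))" by (simp add: complex_eq_iff)
  have "cmod (\<psi> (adj x * x)) \<le> 1"
    using state_bound[OF \<psi>, of "adj x * x"] by (simp add: cstar_identity x)
  moreover have "Re (\<psi> (adj x * x)) \<noteq> 1" "Re (\<psi> (adj x * x)) \<noteq> - 1"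
    using ne state_ne_minus_one[OF \<psi>, of x] x real by auto
  moreover have "cmod (\<psi> (adj x * x)) = \<bar>Re (\<psi> (adj x * x))\<bar>" by (subst real) simp
  ultimately show ?thesis by linarith
qed

section \<open>Peak sets\<close>

text \<open>
  Both directions match a peak set of \<open>x\<^sup>* x\<close> with \<open>N_Q x\<close>. From a peak set, the norm of \<open>x\<close> must be
  computed from the values of states at \<open>x\<^sup>* x\<close>; conversely, a state outside \<open>N_Q x\<close> avoids the value \<open>1\<close>
  at \<open>x\<^sup>* x\<close>, and avoids \<open>-1\<close> as well by positivity.
\<close>

lemma Q_peak_set_iff:
  assumes "\<omega> \<in> state_space"
  shows "(\<exists>E. E \<noteq> {} \<and> peak_set (Q_set M) E \<and> E \<subseteq> E_set M \<omega>) \<longleftrightarrow> (\<exists>x\<in>M. norm x = 1 \<and> R_Q M x = {restrict \<omega> M})"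
proof
  assume "\<exists>E. E \<noteq> {} \<and> peak_set (Q_set M) E \<and> E \<subseteq> E_set M \<omega>"
  then obtain E a where E: "E \<noteq> {}" "E \<subseteq> E_set M \<omega>" "E \<subseteq> state_space" and a: "a \<in> M"
    and one: "\<And>\<phi>. \<phi> \<in> E \<Longrightarrow> \<phi> (adj a * a) = 1"
    and lt: "\<And>\<psi>. \<psi> \<in> state_space \<Longrightarrow> \<psi> \<notin> E \<Longrightarrow> cmod (\<psi> (adj a * a)) < 1"
    unfolding peak_set_def Q_set_def by blast
  have "norm (adj a * a) \<le> 1"
  proof (rule norm_self_adjoint_le)
    show "adj (adj a * a) = adj a * a" by (simp add: adj_mult adj_adj)
    fix \<phi> :: "'a \<Rightarrow> complex" assume "\<phi> \<in> state_space"
    then show "\<bar>Re (\<phi> (adj a * a))\<bar> \<le> 1"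
      using one[of \<phi>] lt[of \<phi>] abs_Re_le_cmod[of "\<phi> (adj a * a)"] by (cases "\<phi> \<in> E") auto
  qed
  moreover obtain \<phi> where \<phi>: "\<phi> \<in> E" using E by blast
  then have "1 \<le> norm (adj a * a)" using one[of \<phi>] state_bound[of \<phi> "adj a * a"] E by auto
  ultimately have na: "norm a = 1" using cstar_identity[of a] norm_ge_zero[of a]
    by (simp add: power2_eq_1_iff)
  have same: "restrict \<phi> M = restrict \<omega> M" if "\<phi> \<in> E" for \<phi>
    using E(2) that by (auto simp: E_set_def)
  have "N_Q a = E"
    unfolding N_Q_def using one lt E(3) by (force simp: na)
  then have "R_Q M a = (\<lambda>\<phi>. restrict \<phi> M) ` E"
    by (simp add: R_Q_def setcompr_eq_image)
  also have "\<dots> = (\<lambda>_. restrict \<omega> M) ` E" by (rule image_cong[OF refl same])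
  also have "\<dots> = {restrict \<omega> M}" using \<phi> by (rule image_constant)
  finally have "R_Q M a = {restrict \<omega> M}" .
  then show "\<exists>x\<in>M. norm x = 1 \<and> R_Q M x = {restrict \<omega> M}" using a na by blast
next
  assume "\<exists>x\<in>M. norm x = 1 \<and> R_Q M x = {restrict \<omega> M}"
  then obtain x where x: "x \<in> M" "norm x = 1" "R_Q M x = {restrict \<omega> M}" by blast
  have "peak_set (Q_set M) (N_Q x)"
    unfolding peak_set_def
  proof (intro conjI bexI[of _ "adj x * x"])
    show "\<forall>\<psi>\<in>state_space - N_Q x. cmod (\<psi> (adj x * x)) < 1"
      using state_less_one_off_N_Q x(2) by (auto simp: N_Q_def)
  qed (use x in \<open>auto simp: N_Q_def Q_set_def\<close>)
  moreover have "N_Q x \<noteq> {}" using x(3) by (auto simp: R_Q_def)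
  moreover have "N_Q x \<subseteq> E_set M \<omega>"
    using x(3) unfolding R_Q_def E_set_def by (auto simp: N_Q_def)
  ultimately show "\<exists>E. E \<noteq> {} \<and> peak_set (Q_set M) E \<and> E \<subseteq> E_set M \<omega>" by blast
qed

lemma state_le_nr: "\<phi> \<in> state_space \<Longrightarrow> cmod (\<phi> b) \<le> nr b"
  unfolding nr_def by (rule cSUP_upper) (auto intro!: bdd_aboveI2 state_bound)

text \<open>
  A peak set of \<open>x\<close> is \<open>N_nr x\<close>. In the converse direction all states in \<open>N_nr x\<close> have the common value \<open>\<omega> x\<close>
  at \<open>x \<in> M\<close>, a number of modulus 1, so \<open>x\<close> is rotated by its conjugate to peak at the value 1.
\<close>

lemma nr_peak_set_iff:
  assumes M: "complex_vector.subspace M" and \<omega>: "\<omega> \<in> state_space"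
  shows "(\<exists>E. E \<noteq> {} \<and> peak_set M E \<and> E \<subseteq> E_set M \<omega>) \<longleftrightarrow> (\<exists>x\<in>M. nr x = 1 \<and> R_nr M x = {restrict \<omega> M})"
proof
  assume "\<exists>E. E \<noteq> {} \<and> peak_set M E \<and> E \<subseteq> E_set M \<omega>"
  then obtain E x where E: "E \<noteq> {}" "E \<subseteq> E_set M \<omega>" "E \<subseteq> state_space" and x: "x \<in> M"
    and one: "\<And>\<phi>. \<phi> \<in> E \<Longrightarrow> \<phi> x = 1"
    and lt: "\<And>\<psi>. \<psi> \<in> state_space \<Longrightarrow> \<psi> \<notin> E \<Longrightarrow> cmod (\<psi> x) < 1"
    unfolding peak_set_def by blast
  obtain \<phi> where \<phi>: "\<phi> \<in> E" using E by blast
  have "nr x \<le> 1" unfolding nr_def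
  proof (rule cSUP_least)
    show "cmod (\<psi> x) \<le> 1" if "\<psi> \<in> state_space" for \<psi>
      using one[of \<psi>] lt[OF that] by (cases "\<psi> \<in> E") auto
  qed (use \<omega> in blast)
  moreover have "1 \<le> nr x" using state_le_nr[of \<phi> x] one[OF \<phi>] \<phi> E by auto
  ultimately have nx: "nr x = 1" by simp
  have same: "restrict \<phi> M = restrict \<omega> M" if "\<phi> \<in> E" for \<phi>
    using E(2) that by (auto simp: E_set_def)
  have "N_nr x = E"
    unfolding N_nr_def using one lt E(3) by (force simp: nx)
  then have "R_nr M x = (\<lambda>\<phi>. restrict \<phi> M) ` E"
    by (simp add: R_nr_def setcompr_eq_image)
  also have "\<dots> = (\<lambda>_. restrict \<omega> M) ` E" by (rule image_cong[OF refl same])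
  also have "\<dots> = {restrict \<omega> M}" using \<phi> by (rule image_constant)
  finally have "R_nr M x = {restrict \<omega> M}" .
  then show "\<exists>x\<in>M. nr x = 1 \<and> R_nr M x = {restrict \<omega> M}" using x nx by blast
next
  assume "\<exists>x\<in>M. nr x = 1 \<and> R_nr M x = {restrict \<omega> M}"
  then obtain x where x: "x \<in> M" "nr x = 1" "R_nr M x = {restrict \<omega> M}" by blast
  have same: "restrict \<phi> M = restrict \<omega> M" if "\<phi> \<in> N_nr x" for \<phi>
    using x(3) that by (auto simp: R_nr_def)
  have ne: "N_nr x \<noteq> {}" using x(3) by (auto simp: R_nr_def)
  have val: "\<phi> x = \<omega> x" if "\<phi> \<in> N_nr x" for \<phi>
    using fun_cong[OF same[OF that], of x] x(1) by simp
  have unit: "cmod (\<omega> x) = 1" using ne val x(2) by (force simp: N_nr_def)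
  define x' where "x' = cnj (\<omega> x) *\<^sub>C x"
  have state_x': "\<psi> x' = cnj (\<omega> x) * \<psi> x" if "\<psi> \<in> state_space" for \<psi>
    by (simp add: x'_def state_linear[OF that])
  have "peak_set M (N_nr x)"
    unfolding peak_set_def
  proof (intro conjI bexI[of _ x'] ballI)
    show "x' \<in> M" unfolding x'_def by (rule complex_vector.subspace_scale[OF M x(1)])
    show "N_nr x \<subseteq> state_space" by (auto simp: N_nr_def)
    show "\<phi> x' = 1" if "\<phi> \<in> N_nr x" for \<phi>
      using val[OF that] that unit
      by (simp add: state_x' N_nr_def mult.commute[of "cnj _"] flip: complex_norm_square)
    show "cmod (\<psi> x') < 1" if "\<psi> \<in> state_space - N_nr x" for \<psi>
      using that state_le_nr[of \<psi> x] x(2) unit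
      by (auto simp: state_x' norm_mult N_nr_def)
  qed
  moreover have "N_nr x \<subseteq> E_set M \<omega>"
    using same by (auto simp: N_nr_def E_set_def)
  ultimately show "\<exists>E. E \<noteq> {} \<and> peak_set M E \<and> E \<subseteq> E_set M \<omega>" using ne by blast
qed

lemma peak_state_imp_peak_set:
  "\<omega> \<in> state_space \<Longrightarrow> peak_state X \<omega> \<Longrightarrow> \<exists>E. E \<noteq> {} \<and> peak_set X E \<and> E \<subseteq> E_set M \<omega>"
  by (intro exI[of _ "{\<omega>}"]) (simp add: peak_state_def E_set_def)

lemma peak_set_imp_peak_state:
  assumes "\<omega> \<in> state_space" and "\<exists>!\<phi>. \<phi> \<in> state_space \<and> restrict \<phi> M = restrict \<omega> M"
    and "\<exists>E. E \<noteq> {} \<and> peak_set X E \<and> E \<subseteq> E_set M \<omega>"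
  shows "peak_state X \<omega>"
proof -
  have "E_set M \<omega> = {\<omega>}" using assms(1,2) unfolding E_set_def by blast
  then show ?thesis using assms(3) unfolding peak_state_def by (metis subset_singletonD)
qed

theorem proposition4p4:
  fixes M :: "'a::unital_cstar_algebra set" and \<omega> :: "'a \<Rightarrow> complex"
  assumes "unital_subspace M" and "\<omega> \<in> state_space"
  shows
    "let i = peak_state (Q_set M) \<omega>;
         ii = (\<exists>E. E \<noteq> {} \<and> peak_set (Q_set M) E \<and> E \<subseteq> E_set M \<omega>);
         iii = (\<exists>x \<in> M \<inter> Sigma_Q M \<omega>. {restrict \<omega> M} = R_Q M x);
         iv = peak_state M \<omega>;
         v = (\<exists>E. E \<noteq> {} \<and> peak_set M E \<and> E \<subseteq> E_set M \<omega>);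
         vi = (\<exists>x \<in> M \<inter> Sigma_nr M \<omega>. {restrict \<omega> M} = R_nr M x)
     in (i \<longrightarrow> ii) \<and> (ii \<longleftrightarrow> iii) \<and> (iv \<longrightarrow> v) \<and> (v \<longleftrightarrow> vi) \<and>
        ((\<exists>!\<phi>. \<phi> \<in> state_space \<and> restrict \<phi> M = restrict \<omega> M) \<longrightarrow>
          (i \<longleftrightarrow> ii) \<and> (ii \<longleftrightarrow> iii) \<and> (iv \<longleftrightarrow> v) \<and> (v \<longleftrightarrow> vi))"
proof -
  note \<omega> = assms(2)
  have M: "complex_vector.subspace M" using assms(1) by (simp add: unital_subspace_def)
  have iii: "(\<exists>x \<in> M \<inter> Sigma_Q M \<omega>. {restrict \<omega> M} = R_Q M x)
      \<longleftrightarrow> (\<exists>x\<in>M. norm x = 1 \<and> R_Q M x = {restrict \<omega> M})"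
    by (auto simp: Sigma_Q_def)
  have vi: "(\<exists>x \<in> M \<inter> Sigma_nr M \<omega>. {restrict \<omega> M} = R_nr M x)
      \<longleftrightarrow> (\<exists>x\<in>M. nr x = 1 \<and> R_nr M x = {restrict \<omega> M})"
    by (auto simp: Sigma_nr_def)
  show ?thesis
    unfolding Let_def iii vi Q_peak_set_iff[OF \<omega>, symmetric] nr_peak_set_iff[OF M \<omega>, symmetric]
    using peak_state_imp_peak_set[OF \<omega>] peak_set_imp_peak_state[OF \<omega>] by blast
qed

end
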